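(* Let $G$ be a Lie group of dimension $n$ with Lie algebra $\mathfrak g$, $H\in\bigwedge^3\mathfrak g^*$ a closed left-invariant three-form, $g$ a left-invariant pseudo-Riemannian metric and $D^0$ the canonical divergence-free Levi-Civita generalized connection of $(G,H,\mathcal G_g)$. Let $R(u,v)w=D^0_uD^0_vw-D^0_vD^0_uw-D^0_{[u,v]_H}w$ for $u,v,w\in E$ and $R_{ABCD}=\langle R(e_A,e_B)e_C,e_D\rangle$. Then, for $a,b,c,d\in\{1,\dots,n\}$ and $i,j,k,\ell\in\{n+1,\dots,2n\}$, $$R_{ajcd}=\tfrac23\mathcal B_{aj}^\ell\mathcal B_{c\ell d}+\tfrac13\mathcal B_{jc}^\ell\mathcal B_{\ell ad}+\tfrac13\mathcal B_{ca}^\ell\mathcal B_{\ell jd}\quad(\text{sum over }\ell\in\{n+1,\dots,2n\}),$$ $$R_{ibk\ell}=\tfrac23\mathcal B_{ib}^c\mathcal B_{kc\ell}+\tfrac13\mathcal B_{bk}^c\mathcal B_{ci\ell}+\tfrac13\mathcal B_{ki}^c\mathcal B_{cb\ell}\quad(\text{sum over }c\in\{1,\dots,n\}).$$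
   Context: Let $E=\mathfrak g\oplus\mathfrak g^*$, with scalar product $\langle X+\xi,Y+\eta\rangle=\frac12(\xi(Y)+\eta(X))$ and Dorfman bracket $[X+\xi,Y+\eta]_H=[X,Y]-\mathrm{ad}_X^*\eta+\mathrm{ad}_Y^*\xi+H(X,Y,\cdot)$, where $\mathrm{ad}_X^*\eta=\eta\circ\mathrm{ad}_X$. Put $gX=g(X,\cdot)$ and $\mathcal G_g(X+\xi,Y+\eta)=\frac12(g(X,Y)+g^{-1}(\xi,\eta))$. For a $g$-orthonormal basis $(v_1,\dots,v_n)$ of $\mathfrak g$ put $e_a=v_a+gv_a$, $e_{n+a}=v_a-gv_a$ ($a=1,\dots,n$). The coefficients are $\mathcal B_{ABC}=\langle[e_A,e_B]_H,e_C\rangle$, and $\mathcal B_{AB}^C$ defined by $[e_A,e_B]_H=\sum_C\mathcal B_{AB}^Ce_C$, with $A,B,C\in\{1,\dots,2n\}$. The connection $D^0\in E^*\otimes\mathfrak{so}(E)$, $u\mapsto D^0_u$, is defined by $\langle D^0_{e_A}e_B,e_C\rangle=\omega_{ABC}$ with $\omega_{abc}=\frac13\mathcal B_{abc}$, $\omega_{ijk}=\frac13\mathcal B_{ijk}$, $\omega_{ibc}=\mathcal B_{ibc}$, $\omega_{ajk}=\mathcal B_{ajk}$ for $a,b,c\in\{1,\dots,n\}$, $i,j,k\in\{n+1,\dots,2n\}$, and all other components zero. *)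

theory Defs
  imports "HOL-Analysis.Analysis"
begin

text \<open>
  Left-invariant tensor fields on a Lie group are identified with tensors on its Lie algebra
  \<open>\<gg>\<close>, here a finite-dimensional real vector space \<open>'g\<close> with a bracket \<open>br\<close>.  The class
  \<open>euclidean_space\<close> is used only for finite-dimensionality; its inner product plays no role.
  The dual \<open>\<gg>\<^sup>*\<close> is \<open>'g \<Rightarrow>\<^sub>L real\<close>, which contains every linear functional.
\<close>

definition lie_bracket :: "('g::real_vector \<Rightarrow> 'g \<Rightarrow> 'g) \<Rightarrow> bool" where
  "lie_bracket br \<longleftrightarrow>
     bilinear br \<and> (\<forall>x. br x x = 0) \<and>
     (\<forall>x y z. br x (br y z) + br y (br z x) + br z (br x y) = 0)"

definition three_form :: "('g::real_vector \<Rightarrow> 'g \<Rightarrow> 'g \<Rightarrow> real) \<Rightarrow> bool" where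
  "three_form H \<longleftrightarrow>
     (\<forall>y z. linear (\<lambda>x. H x y z)) \<and> (\<forall>x z. linear (\<lambda>y. H x y z)) \<and> (\<forall>x y. linear (\<lambda>z. H x y z)) \<and>
     (\<forall>x y. H x x y = 0 \<and> H x y x = 0 \<and> H y x x = 0)"

text \<open>
  Cartan's formula for \<open>dH\<close> evaluated on four left-invariant vector fields; the terms in which
  a vector field differentiates a value of \<open>H\<close> vanish because these values are constant.
\<close>

definition d3 ::
    "('g::real_vector \<Rightarrow> 'g \<Rightarrow> 'g) \<Rightarrow> ('g \<Rightarrow> 'g \<Rightarrow> 'g \<Rightarrow> real) \<Rightarrow> 'g \<Rightarrow> 'g \<Rightarrow> 'g \<Rightarrow> 'g \<Rightarrow> real" where
  "d3 br H x y z w =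
     - H (br x y) z w + H (br x z) y w - H (br x w) y z
     - H (br y z) x w + H (br y w) x z - H (br z w) x y"

definition closed_three_form ::
    "('g::real_vector \<Rightarrow> 'g \<Rightarrow> 'g) \<Rightarrow> ('g \<Rightarrow> 'g \<Rightarrow> 'g \<Rightarrow> real) \<Rightarrow> bool" where
  "closed_three_form br H \<longleftrightarrow> three_form H \<and> (\<forall>x y z w. d3 br H x y z w = 0)"

definition pseudo_metric :: "('g::real_vector \<Rightarrow> 'g \<Rightarrow> real) \<Rightarrow> bool" where
  "pseudo_metric g \<longleftrightarrow>
     bilinear g \<and> (\<forall>x y. g x y = g y x) \<and> (\<forall>x. (\<forall>y. g x y = 0) \<longrightarrow> x = 0)"

definition orthonormal_basis ::
    "('g::real_vector \<Rightarrow> 'g \<Rightarrow> real) \<Rightarrow> nat \<Rightarrow> (nat \<Rightarrow> 'g) \<Rightarrow> bool" where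
  "orthonormal_basis g n v \<longleftrightarrow>
     inj_on v {1..n} \<and> independent (v ` {1..n}) \<and> span (v ` {1..n}) = UNIV \<and>
     (\<forall>a\<in>{1..n}. \<forall>b\<in>{1..n}. a \<noteq> b \<longrightarrow> g (v a) (v b) = 0) \<and>
     (\<forall>a\<in>{1..n}. g (v a) (v a) = 1 \<or> g (v a) (v a) = -1)"

text \<open>
  Every map below to which \<open>Blinfun\<close> is applied is linear, hence bounded, when \<open>br\<close>, \<open>H\<close> and
  \<open>g\<close> are multilinear.
\<close>

type_synonym 'g gtb = "'g \<times> ('g \<Rightarrow>\<^sub>L real)"

definition pairing :: "'g::euclidean_space gtb \<Rightarrow> 'g gtb \<Rightarrow> real" where
  "pairing u w =
     (blinfun_apply (snd u) (fst w) + blinfun_apply (snd w) (fst u)) / 2"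

definition coad :: "('g::euclidean_space \<Rightarrow> 'g \<Rightarrow> 'g) \<Rightarrow> 'g \<Rightarrow> ('g \<Rightarrow>\<^sub>L real) \<Rightarrow> ('g \<Rightarrow>\<^sub>L real)" where
  "coad br x \<eta> = Blinfun (\<lambda>z. blinfun_apply \<eta> (br x z))"

definition dorfman ::
    "('g::euclidean_space \<Rightarrow> 'g \<Rightarrow> 'g) \<Rightarrow> ('g \<Rightarrow> 'g \<Rightarrow> 'g \<Rightarrow> real) \<Rightarrow>
     'g gtb \<Rightarrow> 'g gtb \<Rightarrow> 'g gtb" where
  "dorfman br H u w =
     (br (fst u) (fst w),
      - coad br (fst u) (snd w) + coad br (fst w) (snd u) + Blinfun (H (fst u) (fst w)))"

definition frame :: "('g::euclidean_space \<Rightarrow> 'g \<Rightarrow> real) \<Rightarrow> nat \<Rightarrow> (nat \<Rightarrow> 'g) \<Rightarrow> nat \<Rightarrow> 'g gtb" where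
  "frame g n v A =
     (if A \<le> n then (v A, Blinfun (g (v A))) else (v (A - n), - Blinfun (g (v (A - n)))))"

definition B_low ::
    "('g::euclidean_space \<Rightarrow> 'g \<Rightarrow> 'g) \<Rightarrow> ('g \<Rightarrow> 'g \<Rightarrow> 'g \<Rightarrow> real) \<Rightarrow>
     (nat \<Rightarrow> 'g gtb) \<Rightarrow> nat \<Rightarrow> nat \<Rightarrow> nat \<Rightarrow> real" where
  "B_low br H e A B C = pairing (dorfman br H (e A) (e B)) (e C)"

text \<open>\<open>B_up br H n e A B C\<close> is \<open>\<B>\<^sub>A\<^sub>B\<^sup>C\<close>, the coefficient of \<open>e C\<close> in \<open>[e A, e B]\<^sub>H\<close>.\<close>

definition B_up ::
    "('g::euclidean_space \<Rightarrow> 'g \<Rightarrow> 'g) \<Rightarrow> ('g \<Rightarrow> 'g \<Rightarrow> 'g \<Rightarrow> real) \<Rightarrow>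
     nat \<Rightarrow> (nat \<Rightarrow> 'g gtb) \<Rightarrow> nat \<Rightarrow> nat \<Rightarrow> nat \<Rightarrow> real" where
  "B_up br H n e A B C = representation (e ` {1..2 * n}) (dorfman br H (e A) (e B)) (e C)"

definition conn_coeff ::
    "('g::euclidean_space \<Rightarrow> 'g \<Rightarrow> 'g) \<Rightarrow> ('g \<Rightarrow> 'g \<Rightarrow> 'g \<Rightarrow> real) \<Rightarrow>
     nat \<Rightarrow> (nat \<Rightarrow> 'g gtb) \<Rightarrow> nat \<Rightarrow> nat \<Rightarrow> nat \<Rightarrow> real" where
  "conn_coeff br H n e A B C =
     (if A \<le> n \<and> B \<le> n \<and> C \<le> n then 1/3 * B_low br H e A B C
      else if A > n \<and> B > n \<and> C > n then 1/3 * B_low br H e A B C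
      else if A > n \<and> B \<le> n \<and> C \<le> n then B_low br H e A B C
      else if A \<le> n \<and> B > n \<and> C > n then B_low br H e A B C
      else 0)"

text \<open>
  The first two conjuncts say \<open>D \<in> E\<^sup>* \<otimes> so(E)\<close>; existence and uniqueness of \<open>D\<close> are
  \<open>canonical_connection_ex1\<close> below.
\<close>

definition canonical_connection ::
    "('g::euclidean_space \<Rightarrow> 'g \<Rightarrow> 'g) \<Rightarrow> ('g \<Rightarrow> 'g \<Rightarrow> 'g \<Rightarrow> real) \<Rightarrow>
     nat \<Rightarrow> (nat \<Rightarrow> 'g gtb) \<Rightarrow> ('g gtb \<Rightarrow> 'g gtb \<Rightarrow> 'g gtb) \<Rightarrow> bool" where
  "canonical_connection br H n e D \<longleftrightarrow>
     bilinear D \<and>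
     (\<forall>u w z. pairing (D u w) z = - pairing w (D u z)) \<and>
     (\<forall>A\<in>{1..2*n}. \<forall>B\<in>{1..2*n}. \<forall>C\<in>{1..2*n}.
        pairing (D (e A) (e B)) (e C) = conn_coeff br H n e A B C)"

definition curvature ::
    "('g::euclidean_space \<Rightarrow> 'g \<Rightarrow> 'g) \<Rightarrow> ('g \<Rightarrow> 'g \<Rightarrow> 'g \<Rightarrow> real) \<Rightarrow>
     ('g gtb \<Rightarrow> 'g gtb \<Rightarrow> 'g gtb) \<Rightarrow> 'g gtb \<Rightarrow> 'g gtb \<Rightarrow> 'g gtb \<Rightarrow> 'g gtb" where
  "curvature br H D u v w = D u (D v w) - D v (D u w) - D (dorfman br H u v) w"

definition curv_coeff ::
    "('g::euclidean_space \<Rightarrow> 'g \<Rightarrow> 'g) \<Rightarrow> ('g \<Rightarrow> 'g \<Rightarrow> 'g \<Rightarrow> real) \<Rightarrow>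
     ('g gtb \<Rightarrow> 'g gtb \<Rightarrow> 'g gtb) \<Rightarrow> (nat \<Rightarrow> 'g gtb) \<Rightarrow>
     nat \<Rightarrow> nat \<Rightarrow> nat \<Rightarrow> nat \<Rightarrow> real" where
  "curv_coeff br H D e A B C F = pairing (curvature br H D (e A) (e B) (e C)) (e F)"


subsection \<open>Well-definedness of the connection\<close>

lemma bounded_linear_Blinfun:
  fixes f :: "'g::euclidean_space \<Rightarrow> real"
  assumes "linear f"
  shows "blinfun_apply (Blinfun f) = f"
  using assms by (simp add: bounded_linear_Blinfun_apply linear_conv_bounded_linear)

lemma bilinear_pairing: "bilinear (pairing :: 'g::euclidean_space gtb \<Rightarrow> _)"
  unfolding bilinear_def pairing_def
  by (auto intro!: linearI simp: blinfun.bilinear_simps algebra_simps add_divide_distrib)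

lemma pairing_commute: "pairing u w = pairing w u"
  by (simp add: pairing_def)

context
  fixes g :: "'g::euclidean_space \<Rightarrow> 'g \<Rightarrow> real" and n :: nat and v :: "nat \<Rightarrow> 'g"
  assumes g: "pseudo_metric g" and v: "orthonormal_basis g n v"
begin

private abbreviation (input) e where "e \<equiv> frame g n v"

lemma pairing_frame:
  assumes "A \<in> {1..2*n}" "B \<in> {1..2*n}"
  shows "A \<noteq> B \<Longrightarrow> pairing (e A) (e B) = 0"
    and "pairing (e A) (e A) * pairing (e A) (e A) = 1"
proof -
  have lin: "linear (g x)" for x using g by (auto simp: pseudo_metric_def bilinear_def)
  have sym: "g x y = g y x" for x y using g by (auto simp: pseudo_metric_def)
  have ap: "blinfun_apply (Blinfun (g x)) y = g x y" for x y
    by (simp add: bounded_linear_Blinfun[OF lin])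
  have o: "g (v a) (v b) = 0" if "a \<in> {1..n}" "b \<in> {1..n}" "a \<noteq> b" for a b
    using v that by (auto simp: orthonormal_basis_def)
  have u: "g (v a) (v a) = 1 \<or> g (v a) (v a) = -1" if "a \<in> {1..n}" for a
    using v that by (auto simp: orthonormal_basis_def)
  let ?p = "\<lambda>A. if A \<le> n then A else A - n" and ?s = "\<lambda>A. if A \<le> n then 1 else -1 :: real"
  have e: "fst (e A) = v (?p A)" "blinfun_apply (snd (e A)) x = ?s A * g (v (?p A)) x" for A x
    by (simp_all add: frame_def ap uminus_blinfun.rep_eq)
  have eq: "pairing (e A) (e B) = (?s A + ?s B) / 2 * g (v (?p A)) (v (?p B))" for A B
    unfolding pairing_def e sym[of "v (?p B)" "v (?p A)"]
    by (simp only: distrib_right times_divide_eq_left)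
  have p: "?p A \<in> {1..n}" "?p B \<in> {1..n}" using assms by auto
  show "pairing (e A) (e B) = 0" if "A \<noteq> B"
  proof (cases "?p A = ?p B")
    case True
    then have "?s A + ?s B = 0" using assms that by (auto split: if_splits)
    then show ?thesis unfolding eq by simp
  next
    case False
    then show ?thesis unfolding eq using o[OF p] by simp
  qed
  show "pairing (e A) (e A) * pairing (e A) (e A) = 1"
    unfolding eq using u[OF p(1)] by auto
qed

lemma inj_frame: "inj_on e {1..2*n}"
  using pairing_frame by (intro inj_onI) (metis mult_zero_left zero_neq_one)

lemma span_frame: "span (e ` {1..2*n}) = UNIV"
proof -
  let ?S = "span (e ` {1..2*n})"
  have lin: "linear (g x)" for x using g by (auto simp: pseudo_metric_def bilinear_def)
  have sp: "span (v ` {1..n}) = UNIV" using v by (auto simp: orthonormal_basis_def)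
  have mem: "e A \<in> ?S" if "A \<in> {1..2*n}" for A using that by (auto intro: span_base)
  have V: "(v a, 0) \<in> ?S" and G: "(0, Blinfun (g (v a))) \<in> ?S" if a: "a \<in> {1..n}" for a
  proof -
    have "e a \<in> ?S" "e (n + a) \<in> ?S" by (rule mem; use a in simp)+
    then have "(1/2) *\<^sub>R (e a + e (n + a)) \<in> ?S" "(1/2) *\<^sub>R (e a - e (n + a)) \<in> ?S"
      by (simp_all only: span_scale span_add span_diff)
    moreover have "(1/2) *\<^sub>R (e a + e (n + a)) = (v a, 0)"
      using a by (simp add: frame_def scaleR_half_double scaleR_2[symmetric])
    moreover have "(1/2) *\<^sub>R (e a - e (n + a)) = (0, Blinfun (g (v a)))"
      using a by (simp add: frame_def scaleR_half_double scaleR_2[symmetric])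
    ultimately show "(v a, 0) \<in> ?S" "(0, Blinfun (g (v a))) \<in> ?S" by simp_all
  qed
  have X: "(x, 0) \<in> ?S" for x
  proof -
    have "x \<in> span (v ` {1..n})" unfolding sp by simp
    then show ?thesis
    proof (induction rule: span_induct_alt)
      case base
      then show ?case by (metis span_zero zero_prod_def)
    next
      case (step c x y)
      then obtain a where a: "a \<in> {1..n}" "x = v a" by blast
      have "c *\<^sub>R (v a, 0) + (y, 0) \<in> ?S"
        by (intro span_add span_scale V a step)
      then show ?case by (simp only: a scaleR_Pair add_Pair scaleR_zero_right add_0_right)
    qed
  qed
  have Xi: "(0, \<xi>) \<in> ?S" for \<xi>
  proof -
    let ?h = "\<Sum>a\<in>{1..n}. (blinfun_apply \<xi> (v a) * g (v a) (v a)) *\<^sub>R Blinfun (g (v a))"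
    have ap: "blinfun_apply ?h y =
        (\<Sum>a\<in>{1..n}. (blinfun_apply \<xi> (v a) * g (v a) (v a)) * g (v a) y)" for y
      by (simp add: blinfun.sum_left blinfun.scaleR_left bounded_linear_Blinfun[OF lin])
    have "blinfun_apply ?h y = blinfun_apply \<xi> y" if y: "y \<in> v ` {1..n}" for y
    proof -
      obtain b where b: "b \<in> {1..n}" "y = v b" using y by blast
      have sq: "g (v b) (v b) * g (v b) (v b) = 1"
      proof -
        have "g (v b) (v b) = 1 \<or> g (v b) (v b) = -1"
          using v b(1) unfolding orthonormal_basis_def by blast
        then show ?thesis by auto
      qed
      have o: "g (v a) (v b) = 0" if "a \<in> {1..n}" "a \<noteq> b" for a
        using v b(1) that unfolding orthonormal_basis_def by blast
      have "blinfun_apply ?h y =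
          (\<Sum>a\<in>{1..n}. if a = b then blinfun_apply \<xi> (v b) * (g (v b) (v b) * g (v b) (v b)) else 0)"
        unfolding ap b(2) by (intro sum.cong refl) (use o in auto)
      then show ?thesis using b sq by simp
    qed
    then have "blinfun_apply ?h y = blinfun_apply \<xi> y" for y
      using linear_eq_on_span[OF bounded_linear.linear[OF blinfun.bounded_linear_right[of ?h]]
          bounded_linear.linear[OF blinfun.bounded_linear_right[of \<xi>]], of "v ` {1..n}" y]
      unfolding sp by blast
    then have h: "\<xi> = ?h" by (intro blinfun_eqI) simp
    have "(0, ?h) = (\<Sum>a\<in>{1..n}. (blinfun_apply \<xi> (v a) * g (v a) (v a)) *\<^sub>R (0, Blinfun (g (v a))))"
      by (simp add: prod_eq_iff fst_sum snd_sum)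
    also have "\<dots> \<in> ?S" by (intro span_sum span_scale G)
    finally show ?thesis by (simp only: h[symmetric])
  qed
  have "u \<in> ?S" for u
    using span_add[OF X[of "fst u"] Xi[of "snd u"]] by (cases u) simp
  then show ?thesis by blast
qed

lemma frame_expansion:
  "u = (\<Sum>A\<in>{1..2*n}. (pairing (e A) (e A) * pairing u (e A)) *\<^sub>R e A)"
proof -
  note bp = bilinear_pairing
  have "u \<in> span (e ` {1..2*n})" unfolding span_frame by simp
  then show ?thesis
  proof (induction rule: span_induct_alt)
    case base
    then show ?case by (simp add: bilinear_lzero[OF bp])
  next
    case (step c x y)
    then obtain B where B: "B \<in> {1..2*n}" "x = e B" by auto
    have "(\<Sum>A\<in>{1..2*n}. (pairing (e A) (e A) * pairing x (e A)) *\<^sub>R e A) =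
        (\<Sum>A\<in>{1..2*n}. if A = B then e B else 0)"
      using B pairing_frame by (intro sum.cong) auto
    then have x: "(\<Sum>A\<in>{1..2*n}. (pairing (e A) (e A) * pairing x (e A)) *\<^sub>R e A) = x"
      using B by simp
    have "(\<Sum>A\<in>{1..2*n}. (pairing (e A) (e A) * pairing (c *\<^sub>R x + y) (e A)) *\<^sub>R e A) =
        c *\<^sub>R (\<Sum>A\<in>{1..2*n}. (pairing (e A) (e A) * pairing x (e A)) *\<^sub>R e A) +
        (\<Sum>A\<in>{1..2*n}. (pairing (e A) (e A) * pairing y (e A)) *\<^sub>R e A)"
      by (simp add: bilinear_ladd[OF bp] bilinear_lmul[OF bp] scaleR_sum_right
          sum.distrib[symmetric] algebra_simps)
    then show ?case using x step(2) by simp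
  qed
qed

lemma pairing_frame_eqI:
  assumes "\<And>A. A \<in> {1..2*n} \<Longrightarrow> pairing u (e A) = pairing w (e A)"
  shows "u = w"
  by (subst frame_expansion[of u], subst frame_expansion[of w]) (use assms in simp)

lemma canonical_connection_ex1:
  assumes br: "lie_bracket br" and H: "closed_three_form br H"
  shows "\<exists>!D. canonical_connection br H n e D"
proof (rule ex_ex1I)
  note bp = bilinear_pairing
  have br_lin: "linear (br x)" for x using br by (auto simp: lie_bracket_def bilinear_def)
  have br_skew: "br x y = - br y x" for x y
  proof -
    have b: "bilinear br" and z: "\<And>x. br x x = 0" using br by (auto simp: lie_bracket_def)
    have "br (x + y) (x + y) = (br x x + br x y) + (br y x + br y y)"
      by (simp only: bilinear_ladd[OF b] bilinear_radd[OF b] add_ac)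
    then have "br x y + br y x = 0" by (simp only: z add_0_left add_0_right)
    then show ?thesis by (simp add: eq_neg_iff_add_eq_0)
  qed
  have H3: "three_form H" using H by (simp add: closed_three_form_def)
  have H_lin: "linear (H x y)" for x y using H3 by (simp add: three_form_def)
  have H_skew: "H x y z = - H x z y" for x y z
  proof -
    have l: "linear (\<lambda>y. H x y w)" for w using H3 by (simp add: three_form_def)
    have d: "H x y y = 0" for y using H3 by (simp add: three_form_def)
    have "H x (y + z) (y + z) = H x y z + H x z y"
      using d by (simp add: linear_add[OF H_lin] linear_add[OF l])
    then show ?thesis using d[of "y + z"] by simp
  qed
  have coad: "blinfun_apply (coad br x \<eta>) z = blinfun_apply \<eta> (br x z)" for x \<eta> z
  proof -
    have "linear (\<lambda>z. blinfun_apply \<eta> (br x z))"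
      using linear_compose[OF br_lin bounded_linear.linear[OF blinfun.bounded_linear_right]]
      by (simp add: o_def)
    then show ?thesis by (simp add: coad_def bounded_linear_Blinfun)
  qed
  have dorfman_skew: "pairing (dorfman br H u w) z = - pairing (dorfman br H u z) w" for u w z
  proof -
    have eq: "pairing (dorfman br H u w) z =
        (- blinfun_apply (snd w) (br (fst u) (fst z)) + blinfun_apply (snd u) (br (fst w) (fst z))
         + H (fst u) (fst w) (fst z) + blinfun_apply (snd z) (br (fst u) (fst w))) / 2" for w z
      by (simp add: pairing_def dorfman_def coad plus_blinfun.rep_eq minus_blinfun.rep_eq uminus_blinfun.rep_eq
          bounded_linear_Blinfun[OF H_lin])
    have "blinfun_apply (snd u) (br (fst w) (fst z)) = - blinfun_apply (snd u) (br (fst z) (fst w))"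
      by (subst br_skew) (rule blinfun.minus_right)
    then show ?thesis
      unfolding eq using H_skew[of "fst u" "fst w" "fst z"] by argo
  qed
  let ?\<omega> = "conn_coeff br H n e"
  have skew: "?\<omega> A B C = - ?\<omega> A C B" for A B C
  proof -
    have "B_low br H e A B C = - B_low br H e A C B"
      unfolding B_low_def by (rule dorfman_skew)
    then show ?thesis unfolding conn_coeff_def by argo
  qed
  let ?s = "\<lambda>A. pairing (e A) (e A)"
  let ?I = "{1..2*n}"
  define D where "D u w = (\<Sum>A\<in>?I. \<Sum>B\<in>?I. \<Sum>C\<in>?I.
    (?s A * pairing u (e A) * (?s B * pairing w (e B)) * ?s C * ?\<omega> A B C) *\<^sub>R e C)" for u w
  have Dp: "pairing (D u w) z = (\<Sum>A\<in>?I. \<Sum>B\<in>?I. \<Sum>C\<in>?I.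
      ?s A * pairing u (e A) * (?s B * pairing w (e B)) * (?s C * pairing z (e C)) * ?\<omega> A B C)"
    for u w z
  proof -
    have lin: "linear (\<lambda>u. pairing u z)" using bp unfolding bilinear_def by blast
    show ?thesis
      unfolding D_def linear_sum[OF lin] linear_scale[OF lin] pairing_commute[of z]
      by (intro sum.cong refl) simp
  qed
  have sym: "pairing (D u w) z = - pairing w (D u z)" for u w z
  proof -
    have "pairing (D u z) w = - pairing (D u w) z"
      unfolding Dp sum_negf[symmetric]
      by (rule sum.cong[OF refl], subst sum.swap, rule sum.cong[OF refl], rule sum.cong[OF refl],
          subst skew) simp
    then show ?thesis by (simp add: pairing_commute[of w])
  qed
  have bil: "bilinear D"
    unfolding bilinear_def D_def
    by (intro conjI allI linearI;
        (unfold sum.distrib[symmetric] scaleR_sum_right)?;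
        intro sum.cong refl; simp add: bilinear_ladd[OF bp] bilinear_lmul[OF bp] algebra_simps)
  have comp: "pairing (D (e A) (e B)) (e C) = ?\<omega> A B C"
    if ABC: "A \<in> ?I" "B \<in> ?I" "C \<in> ?I" for A B C
  proof -
    have d: "?s A' * pairing (e A) (e A') = (if A' = A then 1 else 0)"
      if "A \<in> ?I" "A' \<in> ?I" for A A'
      using pairing_frame[OF that] pairing_frame[OF that(2,1)] by auto
    have "pairing (D (e A) (e B)) (e C) = (\<Sum>A'\<in>?I. \<Sum>B'\<in>?I. \<Sum>C'\<in>?I.
        if C' = C then if B' = B then if A' = A then ?\<omega> A B C else 0 else 0 else 0)"
      unfolding Dp by (intro sum.cong refl) (simp only: d ABC, simp)
    also have "\<dots> = ?\<omega> A B C"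
      using ABC by (simp only: sum.delta finite_atLeastAtMost if_True)
    finally show ?thesis .
  qed
  show "\<exists>D. canonical_connection br H n e D"
    using bil sym comp unfolding canonical_connection_def by blast
next
  note bp = bilinear_pairing
  let ?I = "{1..2*n}"
  fix D D' assume D: "canonical_connection br H n e D" and D': "canonical_connection br H n e D'"
  have eq: "D x y = D' x y" if xy: "x \<in> e ` ?I" "y \<in> e ` ?I" for x y
  proof -
    from xy obtain A B where "A \<in> ?I" "x = e A" "B \<in> ?I" "y = e B" by blast
    then show ?thesis
      using D D' by (intro pairing_frame_eqI) (simp add: canonical_connection_def)
  qed
  have b: "bilinear D" "bilinear D'" using D D' by (simp_all only: canonical_connection_def)
  have "D u w = D' u w" for u w
    by (rule bilinear_eq[OF b, of UNIV "e ` ?I" UNIV "e ` ?I"]) (auto simp only: span_frame eq)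
  then show "D = D'" by blast
qed

end

end

theory Submission
  imports Defs
begin

text \<open>
  The space \<open>E\<close> with the Dorfman bracket is a quadratic Lie algebra, the Jacobi identity being
  equivalent to closedness of \<open>H\<close> given that of \<open>br\<close>.  On its splitting
  \<open>E = E\<^sub>+ \<oplus> E\<^sub>-\<close> the connection is \<open>D\<^sub>x y = 1/3 [x, y]\<^sub>+\<close> for \<open>x, y \<in> E\<^sub>+\<close> and
  \<open>D\<^sub>x y = [x, y]\<^sub>+\<close> for \<open>x \<in> E\<^sub>-\<close>, \<open>y \<in> E\<^sub>+\<close>, so \<open>R(a, j) c\<close> is a combination of double
  brackets of \<open>a, j, c\<close>.  In those with factor \<open>1/3\<close> the inner brackets are projected to \<open>E\<^sub>+\<close>;
  the Jacobi identity trades them for the ones projected to \<open>E\<^sub>-\<close>.  The second formula is the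
  first with \<open>E\<^sub>+\<close> and \<open>E\<^sub>-\<close> exchanged.
\<close>

section \<open>Alternating forms and the Leibniz form of the Jacobi identity\<close>

lemma bilinear_alternating_skew:
  fixes f :: "'a::real_vector \<Rightarrow> 'a \<Rightarrow> 'b::real_vector"
  assumes "bilinear f" "\<And>x. f x x = 0"
  shows "f x y = - f y x"
proof -
  have "f (x + y) (x + y) = f x y + f y x"
    using assms(2)[of x] assms(2)[of y]
    by (simp only: bilinear_ladd[OF assms(1)] bilinear_radd[OF assms(1)]) simp
  then show ?thesis
    using assms(2)[of "x + y"] by (simp add: eq_neg_iff_add_eq_0)
qed

lemma lie_bracket_skew: "lie_bracket br \<Longrightarrow> br x y = - br y x"
  by (rule bilinear_alternating_skew) (auto simp: lie_bracket_def)

lemma lie_bracket_leibniz: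
  assumes "lie_bracket br"
  shows "br (br x y) z = br x (br y z) - br y (br x z)"
proof -
  have b: "bilinear br" and J: "br x (br y z) + br y (br z x) + br z (br x y) = 0"
    using assms by (auto simp: lie_bracket_def)
  have "br z (br x y) = - br (br x y) z"
    by (rule lie_bracket_skew[OF assms])
  moreover have "br y (br z x) = - br y (br x z)"
    using lie_bracket_skew[OF assms, of z x] by (simp add: bilinear_rneg[OF b])
  ultimately show ?thesis
    using J by (simp add: eq_diff_eq diff_eq_eq algebra_simps)
qed

lemma three_form_skew:
  assumes "three_form H"
  shows "H x y z = - H y x z" "H x y z = - H x z y"
proof -
  have b: "bilinear (\<lambda>x y. H x y z)" "bilinear (H x)"
    using assms by (auto simp: three_form_def bilinear_def)
  show "H x y z = - H y x z"
    by (rule bilinear_alternating_skew[OF b(1)]) (use assms in \<open>simp add: three_form_def\<close>)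
  show "H x y z = - H x z y"
    by (rule bilinear_alternating_skew[OF b(2)]) (use assms in \<open>simp add: three_form_def\<close>)
qed

lemma gtb_eqI:
  fixes u w :: "'g::euclidean_space gtb"
  assumes "fst u = fst w" "\<And>z. blinfun_apply (snd u) z = blinfun_apply (snd w) z"
  shows "u = w"
  using assms by (intro prod_eqI blinfun_eqI) auto

section \<open>The Dorfman bracket on left-invariant sections is a Lie bracket\<close>

context
  fixes br :: "'g::euclidean_space \<Rightarrow> 'g \<Rightarrow> 'g" and H :: "'g \<Rightarrow> 'g \<Rightarrow> 'g \<Rightarrow> real"
  assumes br: "lie_bracket br" and H: "closed_three_form br H"
begin

lemma fst_dorfman: "fst (dorfman br H u w) = br (fst u) (fst w)"
  by (simp add: dorfman_def)

lemma snd_dorfman: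
  "blinfun_apply (snd (dorfman br H u w)) z =
     - blinfun_apply (snd w) (br (fst u) z) + blinfun_apply (snd u) (br (fst w) z)
     + H (fst u) (fst w) z"
proof -
  have "linear (H x y)" for x y
    using H by (simp add: closed_three_form_def three_form_def)
  moreover have "linear (\<lambda>z. blinfun_apply \<eta> (br x z))" for x and \<eta> :: "'g \<Rightarrow>\<^sub>L real"
  proof -
    have "linear (br x)" using br by (auto simp: lie_bracket_def bilinear_def)
    from linear_compose[OF this bounded_linear.linear[OF blinfun.bounded_linear_right]]
    show ?thesis by (simp add: o_def)
  qed
  ultimately show ?thesis
    by (simp add: dorfman_def coad_def bounded_linear_Blinfun plus_blinfun.rep_eq
        minus_blinfun.rep_eq uminus_blinfun.rep_eq)
qed

lemma bilinear_dorfman: "bilinear (dorfman br H)"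
proof -
  have b: "bilinear br" using br by (simp add: lie_bracket_def)
  have H3: "three_form H" using H by (simp add: closed_three_form_def)
  have l: "linear (\<lambda>x. H x y z)" "linear (\<lambda>y. H x y z)" for x y z
    using H3 by (simp_all add: three_form_def)
  note lin = linear_add[OF l(1)] linear_add[OF l(2)] linear_scale[OF l(1)] linear_scale[OF l(2)]
  show ?thesis
    unfolding bilinear_def
    by (intro conjI allI linearI gtb_eqI)
      (simp_all add: fst_dorfman snd_dorfman bilinear_ladd[OF b] bilinear_radd[OF b]
        bilinear_lmul[OF b] bilinear_rmul[OF b] blinfun.bilinear_simps lin algebra_simps)
qed

text \<open>The symmetric part of a Dorfman bracket is, up to a factor, the differential of the
  pairing. Pairings of left-invariant sections are constant, so it vanishes.\<close>

lemma dorfman_skew: "dorfman br H u w = - dorfman br H w u"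
proof -
  have "three_form H" using H by (simp add: closed_three_form_def)
  from three_form_skew(1)[OF this, of "fst u" "fst w"] lie_bracket_skew[OF br, of "fst u" "fst w"]
  show ?thesis
    by (intro gtb_eqI) (simp_all add: fst_dorfman snd_dorfman uminus_blinfun.rep_eq)
qed

text \<open>In the vector part this is the Leibniz rule of \<open>br\<close>. In the covector part
  the terms with \<open>snd u\<close>, \<open>snd v\<close>, \<open>snd w\<close> cancel by the same
  rule, and the terms with \<open>H\<close> sum to zero because \<open>H\<close> is closed.\<close>

lemma dorfman_leibniz:
  "dorfman br H u (dorfman br H v w) =
     dorfman br H (dorfman br H u v) w + dorfman br H v (dorfman br H u w)"
proof (rule gtb_eqI)
  show "fst (dorfman br H u (dorfman br H v w)) =
      fst (dorfman br H (dorfman br H u v) w + dorfman br H v (dorfman br H u w))"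
    by (simp add: fst_dorfman lie_bracket_leibniz[OF br])
next
  fix z
  let ?x = "fst u" and ?y = "fst v" and ?t = "fst w"
  have sk: "H a b c = - H b a c" "H a b c = - H a c b" for a b c
    using three_form_skew H by (auto simp: closed_three_form_def)
  \<comment> \<open>Cyclic shifts and skew-symmetry bring the six terms of \<open>d3\<close> to the
    argument orders that \<open>snd_dorfman\<close> produces.\<close>
  have "H a b c = H c a b" for a b c
    using sk(1)[of a c b] sk(2)[of a b c] by simp
  note cyc = this[of ?y ?t "br ?x z"] this[of ?x ?y "br ?t z"] this[of ?x ?t "br ?y z"]
  have "d3 br H ?x ?y ?t z = 0" using H by (simp add: closed_three_form_def)
  then have "H ?x (br ?y ?t) z - H ?y ?t (br ?x z) =
      H (br ?x ?y) ?t z + H ?x ?y (br ?t z) + H ?y (br ?x ?t) z - H ?x ?t (br ?y z)"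
    using cyc sk(1)[of ?x "br ?y ?t" z] sk(1)[of ?y "br ?x ?t" z] unfolding d3_def by linarith
  then show "blinfun_apply (snd (dorfman br H u (dorfman br H v w))) z =
      blinfun_apply (snd (dorfman br H (dorfman br H u v) w + dorfman br H v (dorfman br H u w))) z"
    by (simp add: fst_dorfman snd_dorfman lie_bracket_leibniz[OF br] blinfun.bilinear_simps)
qed

end

section \<open>Curvature in an abstract split Lie algebra\<close>

text \<open>Split each inner bracket by \<open>p\<close> and \<open>q\<close>. All three
  \<open>p\<close>-parts enter with factor 1/3, so the Jacobi identity under \<open>p\<close>
  replaces them by \<open>q\<close>-parts. \<open>D (L a j) c\<close> already contains the
  \<open>q\<close>-part of \<open>L a j\<close> with factor 1, whence 1 - 1/3 = 2/3.\<close>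

lemma curvature_split_lie_algebra:
  fixes L D :: "'a::real_vector \<Rightarrow> 'a \<Rightarrow> 'a" and p :: "'a \<Rightarrow> 'a"
  assumes L: "bilinear L" and D: "bilinear D" and p: "linear p"
    and jacobi: "\<And>x y z. L x (L y z) = L (L x y) z + L y (L x z)"
    and pp: "\<And>x. p (p x) = p x"
    and D_same: "\<And>x y. p x = x \<Longrightarrow> p y = y \<Longrightarrow> D x y = (1/3) *\<^sub>R p (L x y)"
    and D_mixed: "\<And>x y. p x = 0 \<Longrightarrow> p y = y \<Longrightarrow> D x y = p (L x y)"
    and a: "p a = a" and j: "p j = 0" and c: "p c = c"
    and q: "\<And>x. q x = x - p x"
  shows "D a (D j c) - D j (D a c) - D (L a j) c =
    (1/3) *\<^sub>R p (L j (q (L a c))) - (1/3) *\<^sub>R p (L a (q (L j c))) - (2/3) *\<^sub>R p (L (q (L a j)) c)"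
proof -
  have "D (L a j) c = D (p (L a j)) c + D (q (L a j)) c"
    by (simp add: q bilinear_ladd[OF D, symmetric])
  also have "\<dots> = (1/3) *\<^sub>R p (L (p (L a j)) c) + p (L (q (L a j)) c)"
    using c by (simp add: D_same D_mixed pp q linear_diff[OF p])
  finally have 1: "D (L a j) c = \<dots>" .
  have 2: "D a (D j c) = (1/3) *\<^sub>R p (L a (p (L j c)))"
    using a j c by (simp add: D_same D_mixed pp)
  have 3: "D j (D a c) = (1/3) *\<^sub>R p (L j (p (L a c)))"
    using a j c by (simp add: D_same D_mixed pp bilinear_rmul[OF D])
  have "p (L a (L j c)) = p (L (L a j) c) + p (L j (L a c))"
    using jacobi[of a j c] by (simp add: linear_add[OF p])
  then have "(1/3) *\<^sub>R p (L a (L j c)) = (1/3) *\<^sub>R p (L (L a j) c) + (1/3) *\<^sub>R p (L j (L a c))"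
    by (simp add: scaleR_add_right[symmetric])
  \<comment> \<open>Unit multiples are broken into thirds so that only additive cancellation
    remains.\<close>
  moreover have "p (L (L a j) c) = (1/3) *\<^sub>R p (L (L a j) c) + (2/3) *\<^sub>R p (L (L a j) c)"
      "p (L (p (L a j)) c) = (1/3) *\<^sub>R p (L (p (L a j)) c) + (2/3) *\<^sub>R p (L (p (L a j)) c)"
    by (simp_all add: scaleR_add_left[symmetric])
  ultimately show ?thesis
    unfolding 1 2 3 q
    by (simp add: bilinear_lsub[OF L] bilinear_rsub[OF L] linear_diff[OF p] algebra_simps)
qed

section \<open>Coefficients and projections in the frame\<close>

text \<open>
  The factor \<open>pairing (e A) (e A)\<close> is \<open>1\<close> or \<open>-1\<close> for the frames below, hence its own inverse.
\<close>

definition frame_proj :: "(nat \<Rightarrow> 'g::euclidean_space gtb) \<Rightarrow> nat set \<Rightarrow> 'g gtb \<Rightarrow> 'g gtb" where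
  "frame_proj e S u = (\<Sum>A\<in>S. (pairing (e A) (e A) * pairing u (e A)) *\<^sub>R e A)"

lemma linear_frame_proj: "linear (frame_proj e S)"
  unfolding frame_proj_def
  by (intro linearI)
    (simp_all add: bilinear_ladd[OF bilinear_pairing] bilinear_lmul[OF bilinear_pairing]
      scaleR_sum_right sum.distrib[symmetric] algebra_simps)

context
  fixes g :: "'g::euclidean_space \<Rightarrow> 'g \<Rightarrow> real" and n :: nat and v :: "nat \<Rightarrow> 'g"
    and e :: "nat \<Rightarrow> 'g gtb"
  assumes g: "pseudo_metric g" and v: "orthonormal_basis g n v" and e: "e = frame g n v"
begin

lemma frame_coefficient:
  assumes "S \<subseteq> {1..2*n}" "A \<in> {1..2*n}"
  shows "pairing (e A) (e A) * pairing (\<Sum>B\<in>S. c B *\<^sub>R e B) (e A) = (if A \<in> S then c A else 0)"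
proof -
  note pf = pairing_frame[OF g v, folded e]
  have lin: "linear (\<lambda>u. pairing u (e A))"
    using bilinear_pairing unfolding bilinear_def by blast
  have "pairing (\<Sum>B\<in>S. c B *\<^sub>R e B) (e A) = (\<Sum>B\<in>S. if B = A then c A * pairing (e A) (e A) else 0)"
    unfolding linear_sum[OF lin] linear_scale[OF lin]
    using assms pf(1) by (intro sum.cong) auto
  moreover have "finite S"
    using assms(1) finite_subset by blast
  ultimately show ?thesis
    using pf(2)[OF assms(2,2)] by simp
qed

lemma pairing_frame_proj:
  assumes "S \<subseteq> {1..2*n}" "A \<in> {1..2*n}"
  shows "pairing (frame_proj e S u) (e A) = (if A \<in> S then pairing u (e A) else 0)"
proof -
  have "pairing (e A) (e A) * pairing (frame_proj e S u) (e A)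
      = pairing (e A) (e A) * (if A \<in> S then pairing u (e A) else 0)"
    unfolding frame_proj_def frame_coefficient[OF assms] by simp
  moreover have "pairing (e A) (e A) \<noteq> 0"
    using pairing_frame(2)[OF g v assms(2,2), folded e] by auto
  ultimately show ?thesis by simp
qed

lemma frame_eqI: "(\<And>A. A \<in> {1..2*n} \<Longrightarrow> pairing u (e A) = pairing w (e A)) \<Longrightarrow> u = w"
  using pairing_frame_eqI[OF g v, folded e] .

lemma frame_proj_idem:
  assumes "S \<subseteq> {1..2*n}"
  shows "frame_proj e S (frame_proj e S u) = frame_proj e S u"
  by (rule frame_eqI) (simp add: pairing_frame_proj[OF assms])

lemma frame_proj_frame:
  assumes "S \<subseteq> {1..2*n}" "A \<in> {1..2*n}"
  shows "frame_proj e S (e A) = (if A \<in> S then e A else 0)"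
proof (rule frame_eqI)
  fix B assume B: "B \<in> {1..2*n}"
  show "pairing (frame_proj e S (e A)) (e B) = pairing (if A \<in> S then e A else 0) (e B)"
    using pairing_frame(1)[OF g v assms(2) B, folded e]
    by (cases "A = B") (simp_all add: pairing_frame_proj[OF assms(1) B] bilinear_lzero[OF bilinear_pairing])
qed

lemma frame_proj_compl:
  assumes "S \<subseteq> {1..2*n}"
  shows "frame_proj e ({1..2*n} - S) u = u - frame_proj e S u"
  by (rule frame_eqI)
    (use assms in \<open>auto simp: pairing_frame_proj bilinear_lsub[OF bilinear_pairing]\<close>)

lemma frame_proj_in_span: "frame_proj e S u \<in> span (e ` S)"
  unfolding frame_proj_def by (intro span_sum span_scale span_base) simp

text \<open>\<open>representation\<close> is zero by default on a dependent set, so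
  \<open>B_up\<close> yields true coefficients only through this fact. Pairing a vanishing
  combination with each frame vector isolates its coefficients.\<close>

lemma independent_frame: "independent (e ` {1..2*n})"
proof -
  have inj: "inj_on e {1..2*n}" using inj_frame[OF g v] e by simp
  show ?thesis
    unfolding independent_explicit_finite_subsets
  proof (intro allI impI ballI)
    fix T c x
    assume T: "T \<subseteq> e ` {1..2*n}" "finite T" and z: "(\<Sum>w\<in>T. c w *\<^sub>R w) = 0" and x: "x \<in> T"
    obtain S where S: "S \<subseteq> {1..2*n}" "T = e ` S" using T(1) by (meson subset_imageE)
    obtain A where A: "A \<in> S" "x = e A" using x S by blast
    have "(\<Sum>B\<in>S. c (e B) *\<^sub>R e B) = 0"
      using z S inj by (simp add: sum.reindex inj_on_subset)
    then show "c x = 0"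
      using frame_coefficient[OF S(1) subsetD[OF S(1) A(1)], of "\<lambda>B. c (e B)"] A
      by (simp add: bilinear_lzero[OF bilinear_pairing])
  qed
qed

text \<open>In an orthogonal frame with squares 1 or -1, raising an index only multiplies by the
  sign \<open>pairing (e C) (e C)\<close>.\<close>

lemma B_up_eq:
  assumes "C \<in> {1..2*n}"
  shows "B_up br H n e A B C = pairing (e C) (e C) * pairing (dorfman br H (e A) (e B)) (e C)"
proof -
  let ?u = "dorfman br H (e A) (e B)" and ?I = "{1..2*n}"
  have inj: "inj_on e ?I" using inj_frame[OF g v] e by simp
  have u: "?u \<in> span (e ` ?I)" using span_frame[OF g v] e by simp
  have "(\<Sum>b\<in>e ` ?I. representation (e ` ?I) ?u b *\<^sub>R b) = ?u"
    by (rule sum_representation_eq[OF independent_frame u]) auto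
  then have "(\<Sum>B\<in>?I. representation (e ` ?I) ?u (e B) *\<^sub>R e B) = ?u"
    using inj by (simp add: sum.reindex)
  then show ?thesis
    using frame_coefficient[OF subset_refl assms, of "\<lambda>B. representation (e ` ?I) ?u (e B)"] assms
    by (simp add: B_up_def)
qed

lemma frame_proj_dorfman:
  assumes "S \<subseteq> {1..2*n}"
  shows "frame_proj e S (dorfman br H (e A) (e B)) = (\<Sum>C\<in>S. B_up br H n e A B C *\<^sub>R e C)"
  unfolding frame_proj_def using assms by (intro sum.cong) (auto simp: B_up_eq)

section \<open>Connection and mixed curvature in terms of brackets\<close>

text \<open>Passes from components to operators: both sides are bilinear and agree on frame vectors,
  and arguments fixed by the projections lie in the spans of these. The factor \<open>r\<close> will
  be 1/3 or 1.\<close>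

lemma connection_on_frame_proj:
  fixes br H
  assumes br: "lie_bracket br" and H: "closed_three_form br H"
    and D: "bilinear D" and S: "S \<subseteq> {1..2*n}" and T: "T \<subseteq> {1..2*n}"
    and coeff: "\<And>A B C. A \<in> T \<Longrightarrow> B \<in> S \<Longrightarrow> C \<in> {1..2*n} \<Longrightarrow>
      pairing (D (e A) (e B)) (e C) = (if C \<in> S then r * B_low br H e A B C else 0)"
    and x: "frame_proj e T x = x" and y: "frame_proj e S y = y"
  shows "D x y = r *\<^sub>R frame_proj e S (dorfman br H x y)"
proof -
  note bd = bilinear_dorfman[OF br H]
  have b: "bilinear (\<lambda>x y. r *\<^sub>R frame_proj e S (dorfman br H x y))"
    unfolding bilinear_def
    by (intro conjI allI linearI)
      (simp_all add: bilinear_ladd[OF bd] bilinear_radd[OF bd] bilinear_lmul[OF bd] bilinear_rmul[OF bd]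
        linear_add[OF linear_frame_proj] linear_scale[OF linear_frame_proj] scaleR_add_right)
  have "D x y = r *\<^sub>R frame_proj e S (dorfman br H x y)" if "x \<in> e ` T" "y \<in> e ` S" for x y
    using that
    by (intro frame_eqI)
      (auto simp: coeff pairing_frame_proj[OF S] bilinear_lmul[OF bilinear_pairing] B_low_def)
  then show ?thesis
    using bilinear_eq[OF D b, of "span (e ` T)" "e ` T" "span (e ` S)" "e ` S" x y]
      frame_proj_in_span[of T x] frame_proj_in_span[of S y] x y by auto
qed

text \<open>Stating this for a half \<open>S\<close> of the frame and its complement
  \<open>T\<close> covers both formulas. In the bracket expression for the curvature, pairing with
  \<open>e d\<close> absorbs the outer projection to \<open>S\<close>, while expanding the inner one
  to \<open>T\<close> gives the sum over \<open>l\<close>.\<close>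

lemma curv_coeff_mixed:
  fixes br H
  assumes br: "lie_bracket br" and H: "closed_three_form br H" and D: "bilinear D"
    and S: "S \<subseteq> {1..2*n}" and T: "T = {1..2*n} - S"
    and same: "\<And>A B C. A \<in> S \<Longrightarrow> B \<in> S \<Longrightarrow> C \<in> {1..2*n} \<Longrightarrow>
      pairing (D (e A) (e B)) (e C) = (if C \<in> S then 1/3 * B_low br H e A B C else 0)"
    and mixed: "\<And>A B C. A \<in> T \<Longrightarrow> B \<in> S \<Longrightarrow> C \<in> {1..2*n} \<Longrightarrow>
      pairing (D (e A) (e B)) (e C) = (if C \<in> S then B_low br H e A B C else 0)"
    and a: "a \<in> S" and j: "j \<in> T" and c: "c \<in> S" and d: "d \<in> S"
  shows "curv_coeff br H D e a j c d =
    (\<Sum>l\<in>T. 2/3 * B_up br H n e a j l * B_low br H e c l d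
        + 1/3 * B_up br H n e j c l * B_low br H e l a d
        + 1/3 * B_up br H n e c a l * B_low br H e l j d)"
proof -
  let ?L = "dorfman br H" and ?p = "frame_proj e S" and ?q = "frame_proj e T"
  have T': "T \<subseteq> {1..2*n}" using T by auto
  have q: "?q u = u - ?p u" for u
    unfolding T by (rule frame_proj_compl[OF S])
  have D_same: "D x y = (1/3) *\<^sub>R ?p (?L x y)" if "?p x = x" "?p y = y" for x y
    by (rule connection_on_frame_proj[OF br H D S S _ that]) (rule same)
  \<comment> \<open>\<open>?p x = 0\<close> means that \<open>?q\<close> fixes
    \<open>x\<close>.\<close>
  have D_mixed: "D x y = ?p (?L x y)" if "?p x = 0" "?p y = y" for x y
    using connection_on_frame_proj[OF br H D S T', of 1 x y] that q[of x] mixed by simp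
  have pe: "?p (e a) = e a" "?p (e j) = 0" "?p (e c) = e c"
    using a j c S T by (auto simp: frame_proj_frame[OF S] subset_iff)
  have R: "curvature br H D (e a) (e j) (e c) =
      (1/3) *\<^sub>R ?p (?L (e j) (?q (?L (e a) (e c)))) - (1/3) *\<^sub>R ?p (?L (e a) (?q (?L (e j) (e c))))
      - (2/3) *\<^sub>R ?p (?L (?q (?L (e a) (e j))) (e c))"
    unfolding curvature_def
    by (rule curvature_split_lie_algebra[where L = ?L and D = D and p = ?p and q = ?q])
      (fact bilinear_dorfman[OF br H] D linear_frame_proj dorfman_leibniz[OF br H]
        frame_proj_idem[OF S] pe q D_same D_mixed)+
  have sk: "?L x y = - ?L y x" for x y by (rule dorfman_skew[OF br H])
  have skB: "B_low br H e A B C = - B_low br H e B A C" for A B C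
    unfolding B_low_def by (subst sk) (rule bilinear_lneg[OF bilinear_pairing])
  have skU: "B_up br H n e A B C = - B_up br H n e B A C" if "C \<in> T" for A B C
    using that T by (subst (1 2) B_up_eq)
      (auto, subst sk, simp only: bilinear_lneg[OF bilinear_pairing])
  have double: "pairing (?p (?L (e A) (?q (?L (e B) (e C))))) (e d) =
      (\<Sum>l\<in>T. B_up br H n e B C l * B_low br H e A l d)" for A B C
  proof -
    have lin: "linear (\<lambda>w. pairing (?L (e A) w) (e d))"
      using linear_compose[of "?L (e A)" "\<lambda>u. pairing u (e d)"] bilinear_dorfman[OF br H]
        bilinear_pairing unfolding bilinear_def o_def by blast
    have "pairing (?p (?L (e A) (?q (?L (e B) (e C))))) (e d)
        = pairing (?L (e A) (?q (?L (e B) (e C)))) (e d)"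
      using d S by (subst pairing_frame_proj[OF S]) auto
    also have "\<dots> = (\<Sum>l\<in>T. B_up br H n e B C l * B_low br H e A l d)"
      unfolding frame_proj_dorfman[OF T'] linear_sum[OF lin] linear_scale[OF lin]
      by (simp add: B_low_def)
    finally show ?thesis .
  qed
  \<comment> \<open>The projected inner bracket is moved to the right, where \<open>double\<close>
    applies; this turns the coefficient -2/3 into 2/3.\<close>
  have "?p (?L (?q (?L (e a) (e j))) (e c)) = - ?p (?L (e c) (?q (?L (e a) (e j))))"
    by (subst sk) (rule linear_neg[OF linear_frame_proj])
  then have "curv_coeff br H D e a j c d =
      1/3 * (\<Sum>l\<in>T. B_up br H n e a c l * B_low br H e j l d)
      - 1/3 * (\<Sum>l\<in>T. B_up br H n e j c l * B_low br H e a l d)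
      + 2/3 * (\<Sum>l\<in>T. B_up br H n e a j l * B_low br H e c l d)"
    unfolding curv_coeff_def R
    by (simp add: bilinear_lsub[OF bilinear_pairing] bilinear_ladd[OF bilinear_pairing]
        bilinear_lneg[OF bilinear_pairing] bilinear_lmul[OF bilinear_pairing] double)
  \<comment> \<open>Reversing \<open>a c\<close> and \<open>j l\<close> costs two signs, which
    cancel; reversing \<open>a l\<close> absorbs the minus sign of the middle sum.\<close>
  also have "\<dots> = (\<Sum>l\<in>T. 2/3 * B_up br H n e a j l * B_low br H e c l d
        + 1/3 * B_up br H n e j c l * B_low br H e l a d
        + 1/3 * B_up br H n e c a l * B_low br H e l j d)"
    unfolding sum_distrib_left sum_subtractf[symmetric] sum.distrib[symmetric]
    by (intro sum.cong refl, subst skU[of _ a c], assumption, subst skB[of j], subst skB[of a]) simp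
  finally show ?thesis .
qed

end

theorem proposition2p19:
  fixes br :: "'g::euclidean_space \<Rightarrow> 'g \<Rightarrow> 'g"
    and H :: "'g \<Rightarrow> 'g \<Rightarrow> 'g \<Rightarrow> real"
    and g :: "'g \<Rightarrow> 'g \<Rightarrow> real"
    and n :: nat
    and v :: "nat \<Rightarrow> 'g"
    and e :: "nat \<Rightarrow> 'g gtb"
    and D :: "'g gtb \<Rightarrow> 'g gtb \<Rightarrow> 'g gtb"
  assumes "lie_bracket br"
    and "n = DIM('g)"
    and "closed_three_form br H"
    and "pseudo_metric g"
    and "orthonormal_basis g n v"
    and "e = frame g n v"
    and "canonical_connection br H n e D"
  shows "(\<forall>a\<in>{1..n}. \<forall>j\<in>{n+1..2*n}. \<forall>c\<in>{1..n}. \<forall>d\<in>{1..n}.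
           curv_coeff br H D e a j c d =
             (\<Sum>l\<in>{n+1..2*n}.
                2/3 * B_up br H n e a j l * B_low br H e c l d
              + 1/3 * B_up br H n e j c l * B_low br H e l a d
              + 1/3 * B_up br H n e c a l * B_low br H e l j d))
       \<and> (\<forall>i\<in>{n+1..2*n}. \<forall>b\<in>{1..n}. \<forall>k\<in>{n+1..2*n}. \<forall>l\<in>{n+1..2*n}.
           curv_coeff br H D e i b k l =
             (\<Sum>c\<in>{1..n}.
                2/3 * B_up br H n e i b c * B_low br H e k c l
              + 1/3 * B_up br H n e b k c * B_low br H e c i l
              + 1/3 * B_up br H n e k i c * B_low br H e c b l))"
proof -
  note e = assms(6)
  have D: "bilinear D"
    and coeff: "\<And>A B C. A \<in> {1..2*n} \<Longrightarrow> B \<in> {1..2*n} \<Longrightarrow> C \<in> {1..2*n} \<Longrightarrow>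
      pairing (D (e A) (e B)) (e C) = conn_coeff br H n e A B C"
    using assms(7) by (auto simp: canonical_connection_def)
  \<comment> \<open>The first formula takes \<open>S\<close> to be \<open>{1..n}\<close>, the second
    \<open>{n+1..2*n}\<close>; each is the complement of the other.\<close>
  have compl: "{n+1..2*n} = {1..2*n} - {1..n}" "{1..n} = {1..2*n} - {n+1..2*n}"
    by auto
  note curv = curv_coeff_mixed[OF assms(4,5) e assms(1,3) D]
  show ?thesis
    by (intro conjI ballI; rule curv; (rule compl)?; auto simp: coeff conn_coeff_def)
qed

end
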